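(* Let $n,m$ be integers with $1<n\le m$. Then the array $\mathbb{F}(n,m)$ is minimum, and thus extremal, in $\mathcal{M}(n,m)$. In addition, $$S(n,m) = |\operatorname{supp}\mathbb{F}(n,m)| = n+m-\gcd(n,m).$$
   Context: For positive integers $n,m$, an $n\times m$ real array $A=(a_{i,j})$ with all $a_{i,j}\ge 0$ is called doubly stochastic (with uniform marginals) if $\sum_{i=1}^n a_{i,j}=n$ for every column $j=1,\dots,m$ and $\sum_{j=1}^m a_{i,j}=m$ for every row $i=1,\dots,n$. The set of all such arrays is denoted $\mathcal{M}(n,m)$; it is a convex set. An array $M\in\mathcal{M}(n,m)$ is extremal if it is an extreme point of the convex set $\mathcal{M}(n,m)$, i.e. it cannot be written as a convex combination of elements of $\mathcal{M}(n,m)$ different from $M$. The support $\operatorname{supp} A$ is the set of positions $(i,j)$ with $a_{i,j}\neq 0$, and $|\operatorname{supp} A|$ is its cardinality. Define $S(n,m)=\min\{|\operatorname{supp} A| : A\in\mathcal{M}(n,m)\}$. An array $M\in\mathcal{M}(n,m)$ is called minimum if $|\operatorname{supp} M|=S(n,m)$. For integers $n,k\ge 1$, $E(n,kn)$ denotes the $n\times kn$ array whose $(i,j)$ entry is $n$ if $(i-1)k<j\le ik$ and $0$ otherwise. The $n\times m$ arrays $\mathbb{F}(n,m)$, for integers $1\le n\le m$, are built following the Euclidean algorithm $m=k_1n+r_1$, $n=k_2r_1+r_2$, $r_1=k_3r_2+r_3$, $\dots$, $r_{t-1}=k_{t+1}r_t$, by assembling the blocks $E(n,k_1n)$, $E(r_1,k_2r_1)^T$,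 $E(r_2,k_3r_2)$, $E(r_3,k_4r_3)^T$, $\dots$ as follows: if $n\mid m$, $m=k_1n$, then $\mathbb{F}(n,m)=E(n,k_1n)$; otherwise, writing $m=k_1n+r_1$ with $0<r_1<n$, $$\mathbb{F}(n,m)=\begin{pmatrix} E(n,k_1n) & | & \mathbb{F}(r_1,n)^{T}\end{pmatrix},$$ where $(X\mid Y)$ means the arrays $X$ and $Y$ (with the same number of rows) placed side by side and ${}^{T}$ denotes transpose. *)

theory Defs
  imports Complex_Main "Jordan_Normal_Form.Matrix"
begin

text \<open>
  Arrays are matrices of type \<^typ>\<open>real mat\<close>, which carry their dimensions.  Rows and columns
  are indexed from 0.
\<close>

definition ds_arrays :: "nat \<Rightarrow> nat \<Rightarrow> real mat set" where
  "ds_arrays n m = {A \<in> carrier_mat n m.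
     (\<forall>i<n. \<forall>j<m. A $$ (i, j) \<ge> 0) \<and>
     (\<forall>j<m. (\<Sum>i<n. A $$ (i, j)) = real n) \<and>
     (\<forall>i<n. (\<Sum>j<m. A $$ (i, j)) = real m)}"

definition supp_mat :: "real mat \<Rightarrow> (nat \<times> nat) set" where
  "supp_mat A = {(i, j). i < dim_row A \<and> j < dim_col A \<and> A $$ (i, j) \<noteq> 0}"

text \<open>
  The type \<^typ>\<open>real mat\<close> is not an instance of \<^class>\<open>real_vector\<close> (the dimensions vary),
  so the finite convex combination of \<open>B 0, \<dots>, B (N - 1)\<close> with weights \<open>c\<close> is formed entrywise.
\<close>

definition convex_combination_of :: "nat \<Rightarrow> nat \<Rightarrow> real mat \<Rightarrow> real mat set \<Rightarrow> bool" where
  "convex_combination_of n m A X \<longleftrightarrow>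
     (\<exists>N (c :: nat \<Rightarrow> real) (B :: nat \<Rightarrow> real mat).
        (\<forall>l<N. B l \<in> X \<and> c l \<ge> 0) \<and> (\<Sum>l<N. c l) = 1 \<and>
        A = mat n m (\<lambda>(i, j). \<Sum>l<N. c l * B l $$ (i, j)))"

definition extremal_array :: "nat \<Rightarrow> nat \<Rightarrow> real mat \<Rightarrow> bool" where
  "extremal_array n m A \<longleftrightarrow>
     A \<in> ds_arrays n m \<and> \<not> convex_combination_of n m A (ds_arrays n m - {A})"

definition min_supp :: "nat \<Rightarrow> nat \<Rightarrow> nat" where
  "min_supp n m = Min {card (supp_mat A) | A. A \<in> ds_arrays n m}"

definition minimum_array :: "nat \<Rightarrow> nat \<Rightarrow> real mat \<Rightarrow> bool" where
  "minimum_array n m A \<longleftrightarrow> A \<in> ds_arrays n m \<and> card (supp_mat A) = min_supp n m"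

text \<open>
  The array $E(n, kn)$ is \<open>E_array n k\<close>: the second argument is the multiplier \<open>k\<close>.  With 1-based
  indices the condition on the positions reads $(i-1)k < j \le ik$.
\<close>

definition E_array :: "nat \<Rightarrow> nat \<Rightarrow> real mat" where
  "E_array n k = mat n (k * n) (\<lambda>(i, j). if i * k \<le> j \<and> j < (i + 1) * k then real n else 0)"

definition beside :: "real mat \<Rightarrow> real mat \<Rightarrow> real mat" where
  "beside X Y = four_block_mat X Y (0\<^sub>m 0 (dim_col X)) (0\<^sub>m 0 (dim_col Y))"

text \<open>
  Only arguments with \<open>1 \<le> n \<le> m\<close> are meaningful; the branch \<open>n = 0\<close> makes the function total.
\<close>

fun F_array :: "nat \<Rightarrow> nat \<Rightarrow> real mat" where
  "F_array n m =
     (if n = 0 then 0\<^sub>m n m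
      else if n dvd m then E_array n (m div n)
      else beside (E_array n (m div n)) (transpose_mat (F_array (m mod n) n)))"

declare F_array.simps [simp del]

end

theory Submission
  imports Defs
begin

text \<open>
  Regard the support of an array \<open>A\<close> in \<open>ds_arrays n m\<close> as the edge set of a bipartite graph on
  the \<open>n\<close> rows and \<open>m\<close> columns.  A union of components with \<open>p\<close> rows and \<open>q\<close> columns carries total
  mass \<open>p * m\<close> when counted by rows and \<open>q * n\<close> when counted by columns, so \<open>p * m = q * n\<close>
  (\<open>balanced_label_class\<close>).  If it is nonempty, this makes \<open>p\<close> a positive multiple of
  \<open>n / gcd n m\<close>; hence there are at most \<open>gcd n m\<close> components.  A graph with \<open>n + m\<close> vertices and
  at most \<open>gcd n m\<close> components has at least \<open>n + m - gcd n m\<close> edges, which is the lower bound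
  \<open>card_supp_lower_bound\<close>.

  The array \<open>F_array n m\<close> attains the bound: one step of the Euclidean algorithm puts down a block
  with \<open>m - r\<close> nonzero entries next to the transpose of \<open>F_array r n\<close>, where \<open>r = m mod n\<close>, and
  \<open>(m - r) + (r + n - gcd r n) = n + m - gcd n m\<close>.

  Finally, minimum support forces extremality.  If \<open>A\<close> were a convex combination of other arrays,
  one of these, \<open>B\<close>, would have its support inside that of \<open>A\<close>.  On the ray that starts in \<open>A\<close> and
  passes through \<open>B\<close>, the last point with nonnegative entries vanishes wherever \<open>A\<close> does and at
  one more position (\<open>smaller_support_exists\<close>), contradicting minimality.
\<close>

section \<open>Sums, transposes and supports of arrays\<close>

lemma ds_arraysI:
  assumes "A \<in> carrier_mat n m"
    and "\<And>i j. i < n \<Longrightarrow> j < m \<Longrightarrow> A $$ (i, j) \<ge> 0"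
    and "\<And>j. j < m \<Longrightarrow> (\<Sum>i<n. A $$ (i, j)) = real n"
    and "\<And>i. i < n \<Longrightarrow> (\<Sum>j<m. A $$ (i, j)) = real m"
  shows "A \<in> ds_arrays n m"
  using assms unfolding ds_arrays_def by blast

lemma ds_arraysD:
  assumes "A \<in> ds_arrays n m"
  shows "A \<in> carrier_mat n m" "dim_row A = n" "dim_col A = m"
    and "i < n \<Longrightarrow> j < m \<Longrightarrow> A $$ (i, j) \<ge> 0"
    and "j < m \<Longrightarrow> (\<Sum>i<n. A $$ (i, j)) = real n"
    and "i < n \<Longrightarrow> (\<Sum>j<m. A $$ (i, j)) = real m"
  using assms unfolding ds_arrays_def by auto

lemma supp_mat_subset: "supp_mat A \<subseteq> {..<dim_row A} \<times> {..<dim_col A}"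
  by (auto simp: supp_mat_def)

lemma finite_supp_mat [simp]: "finite (supp_mat A)"
  by (rule finite_subset[OF supp_mat_subset]) simp

lemma transpose_ds_arrays:
  assumes "A \<in> ds_arrays n m"
  shows "transpose_mat A \<in> ds_arrays m n"
  using ds_arraysD[OF assms] by (intro ds_arraysI) auto

lemma card_supp_transpose: "card (supp_mat (transpose_mat A)) = card (supp_mat A)"
proof -
  have "supp_mat (transpose_mat A) = prod.swap ` supp_mat A"
    by (force simp: supp_mat_def image_iff)
  then show ?thesis by (simp add: card_image)
qed

lemma beside_carrier:
  assumes "X \<in> carrier_mat n a" "Y \<in> carrier_mat n b"
  shows "beside X Y \<in> carrier_mat n (a + b)"
  using assms by (auto simp: beside_def)

lemma beside_index:
  assumes "X \<in> carrier_mat n a" "Y \<in> carrier_mat n b" "i < n" "j < a + b"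
  shows "beside X Y $$ (i, j) = (if j < a then X $$ (i, j) else Y $$ (i, j - a))"
  using assms by (auto simp: beside_def)

lemma beside_ds_arrays:
  assumes X: "X \<in> ds_arrays n a" and Y: "Y \<in> ds_arrays n b"
  shows "beside X Y \<in> ds_arrays n (a + b)"
proof (rule ds_arraysI)
  note x = ds_arraysD[OF X] and y = ds_arraysD[OF Y]
  note ix = beside_index[OF x(1) y(1)]
  show "beside X Y \<in> carrier_mat n (a + b)" using beside_carrier[OF x(1) y(1)] .
  show "beside X Y $$ (i, j) \<ge> 0" if "i < n" "j < a + b" for i j
    using that ix[OF that] x(4) y(4) by auto
  show "(\<Sum>i<n. beside X Y $$ (i, j)) = real n" if "j < a + b" for j
  proof (cases "j < a")
    case True
    then show ?thesis using that ix x(5) by simp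
  next
    case False
    then have "j - a < b" using that by auto
    then show ?thesis using that False ix y(5) by simp
  qed
  show "(\<Sum>j<a + b. beside X Y $$ (i, j)) = real (a + b)" if i: "i < n" for i
  proof -
    have "(\<Sum>j<a + b. beside X Y $$ (i, j))
        = (\<Sum>j<a. beside X Y $$ (i, j)) + (\<Sum>j<b. beside X Y $$ (i, a + j))"
      using sum.atLeastLessThan_concat[of 0 a "a + b" "\<lambda>j. beside X Y $$ (i, j)"]
        sum.shift_bounds_nat_ivl[of "\<lambda>j. beside X Y $$ (i, j)" 0 a b]
      by (simp add: lessThan_atLeast0 add.commute)
    also have "\<dots> = (\<Sum>j<a. X $$ (i, j)) + (\<Sum>j<b. Y $$ (i, j))"
      using ix i by simp
    finally show ?thesis using x(6)[OF i] y(6)[OF i] by simp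
  qed
qed

lemma card_supp_beside:
  assumes X: "X \<in> carrier_mat n a" and Y: "Y \<in> carrier_mat n b"
  shows "card (supp_mat (beside X Y)) = card (supp_mat X) + card (supp_mat Y)"
proof -
  let ?sh = "\<lambda>(i, j). (i, a + j)"
  have dims: "dim_row X = n" "dim_col X = a" "dim_row Y = n" "dim_col Y = b"
    "dim_row (beside X Y) = n" "dim_col (beside X Y) = a + b"
    using X Y beside_carrier[OF X Y] by auto
  have "supp_mat (beside X Y) = supp_mat X \<union> ?sh ` supp_mat Y"
  proof (rule Set.set_eqI)
    fix x :: "nat \<times> nat"
    obtain i j where x: "x = (i, j)" by force
    have "x \<in> ?sh ` supp_mat Y \<longleftrightarrow> a \<le> j \<and> (i, j - a) \<in> supp_mat Y"
      by (force simp: x image_iff)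
    then show "x \<in> supp_mat (beside X Y) \<longleftrightarrow> x \<in> supp_mat X \<union> ?sh ` supp_mat Y"
      using beside_index[OF X Y, of i j]
      by (cases "i < n"; cases "j < a"; cases "j < a + b")
        (simp_all add: x supp_mat_def dims less_diff_conv2 add.commute)
  qed
  moreover have "supp_mat X \<inter> ?sh ` supp_mat Y = {}"
    by (auto simp: supp_mat_def dims)
  moreover have "inj_on ?sh (supp_mat Y)" by (auto simp: inj_on_def)
  ultimately show ?thesis by (simp add: card_Un_disjoint card_image)
qed

section \<open>The Euclidean arrays\<close>

lemma div_eq_iff_block:
  fixes i j k :: nat
  assumes "0 < k"
  shows "i * k \<le> j \<and> j < (i + 1) * k \<longleftrightarrow> i = j div k"
  using assms div_nat_eqI[of k i j] div_times_less_eq_dividend[of j k]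
    dividend_less_div_times[of k j] by (auto simp: mult.commute)

lemma E_array_index:
  assumes "i < n" "j < k * n"
  shows "E_array n k $$ (i, j) = (if i = j div k then real n else 0)"
proof -
  have "0 < k" using assms by (cases k) auto
  then show ?thesis using assms div_eq_iff_block[of k i j] by (simp add: E_array_def)
qed

lemma E_array_carrier: "E_array n k \<in> carrier_mat n (k * n)"
  by (simp add: E_array_def)

lemma E_array_ds_arrays: "E_array n k \<in> ds_arrays n (k * n)"
proof (rule ds_arraysI[OF E_array_carrier])
  show "E_array n k $$ (i, j) \<ge> 0" if "i < n" "j < k * n" for i j
    using that by (simp add: E_array_index)
  show "(\<Sum>i<n. E_array n k $$ (i, j)) = real n" if j: "j < k * n" for j
  proof -
    have "j div k < n" using j by (simp add: less_mult_imp_div_less mult.commute)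
    then show ?thesis using j by (simp add: E_array_index)
  qed
  show "(\<Sum>j<k * n. E_array n k $$ (i, j)) = real (k * n)" if i: "i < n" for i
  proof -
    have "(i + 1) * k \<le> n * k" using i by (intro mult_le_mono1) simp
    then have "{..<k * n} \<inter> {j. i * k \<le> j \<and> j < (i + 1) * k} = {i * k..<(i + 1) * k}"
      by (auto simp: mult.commute)
    moreover have "(\<Sum>j<k * n. E_array n k $$ (i, j))
        = (\<Sum>j<k * n. if j \<in> {j. i * k \<le> j \<and> j < (i + 1) * k} then real n else 0)"
      using i by (intro sum.cong) (auto simp: E_array_def)
    ultimately show ?thesis
      by (simp only: sum.inter_restrict[symmetric] finite_lessThan) simp
  qed
qed

lemma card_supp_E_array:
  assumes "0 < n"
  shows "card (supp_mat (E_array n k)) = k * n"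
proof -
  have "supp_mat (E_array n k) = (\<lambda>j. (j div k, j)) ` {..<k * n}"
  proof (rule Set.set_eqI)
    fix x :: "nat \<times> nat"
    obtain i j where x: "x = (i, j)" by force
    have "j < k * n \<Longrightarrow> j div k < n" by (simp add: less_mult_imp_div_less mult.commute)
    moreover have "x \<in> (\<lambda>j. (j div k, j)) ` {..<k * n} \<longleftrightarrow> i = j div k \<and> j < k * n"
      by (auto simp: x)
    ultimately show "x \<in> supp_mat (E_array n k) \<longleftrightarrow> x \<in> (\<lambda>j. (j div k, j)) ` {..<k * n}"
      using assms E_array_index[of i n j k] E_array_carrier[of n k]
      by (auto simp: x supp_mat_def)
  qed
  then show ?thesis by (simp add: card_image inj_on_def)
qed

text \<open>
  Admitting \<open>n > m\<close> lets the induction follow the recursion without an order condition; for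
  \<open>0 < m < n\<close> the first step places an empty block beside the transpose of \<open>F_array m n\<close>.
\<close>

lemma F_array_ds_arrays_and_card_supp:
  assumes "0 < n"
  shows "F_array n m \<in> ds_arrays n m \<and> card (supp_mat (F_array n m)) = n + m - gcd n m"
  using assms
proof (induction n m rule: F_array.induct)
  case (1 n m)
  show ?case
  proof (cases "n dvd m")
    case True
    then have "F_array n m = E_array n (m div n)"
      using 1(2) by (simp add: F_array.simps)
    then show ?thesis
      using True 1(2) E_array_ds_arrays[of n "m div n"] card_supp_E_array[of n "m div n"] by simp
  next
    case False
    define q r where "q = m div n" and "r = m mod n"
    have r: "0 < r" "q * n + r = m" "gcd r n = gcd n m" "gcd n m \<le> n"
      using False 1(2) gcd_red_nat[of m n]
      by (simp_all add: q_def r_def mod_greater_zero_iff_not_dvd gcd.commute gcd_le1_nat)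
    have IH: "F_array r n \<in> ds_arrays r n" "card (supp_mat (F_array r n)) = r + n - gcd r n"
      using 1(1) 1(2) False r(1) by (simp_all add: r_def)
    have F: "F_array n m = beside (E_array n q) (transpose_mat (F_array r n))"
      using 1(2) False by (subst F_array.simps) (simp add: q_def r_def)
    have T: "transpose_mat (F_array r n) \<in> ds_arrays n r"
      using IH(1) by (rule transpose_ds_arrays)
    have "F_array n m \<in> ds_arrays n m"
      using beside_ds_arrays[OF E_array_ds_arrays[of n q] T] r(2) F by simp
    moreover have "card (supp_mat (F_array n m)) = q * n + (r + n - gcd r n)"
      using card_supp_beside[OF E_array_carrier[of n q] ds_arraysD(1)[OF T]]
        card_supp_E_array[OF 1(2)] IH(2) by (simp add: F card_supp_transpose)
    ultimately show ?thesis using r by simp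
  qed
qed

section \<open>The lower bound for the support\<close>

text \<open>
  A labelling that is constant along edges replaces the partition into components, so this is the
  inequality \<open>components \<ge> vertices - edges\<close>.  Without edges all labels are distinct; an additional
  edge costs at most one label, because it suffices to merge the labels of its two ends.
\<close>

lemma edge_constant_labelling:
  fixes V :: "'v set" and S :: "('v \<times> 'v) set"
  assumes "finite V" "finite S"
  shows "\<exists>f :: 'v \<Rightarrow> 'v. (\<forall>(u, v)\<in>S. f u = f v) \<and> card V \<le> card (f ` V) + card S"
  using assms(2)
proof induction
  case empty
  show ?case by (rule exI[of _ id]) simp
next
  case (insert e S)
  obtain u v where e: "e = (u, v)" by force
  obtain f :: "'v \<Rightarrow> 'v" where f: "\<forall>(u, v)\<in>S. f u = f v" "card V \<le> card (f ` V) + card S"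
    using insert.IH by blast
  define f' where "f' w = (if f w = f u then f v else f w)" for w
  have "f w \<in> insert (f u) (f' ` V)" if "w \<in> V" for w
    using imageI[OF that, of f'] by (simp add: f'_def split: if_splits)
  then have "f ` V \<subseteq> insert (f u) (f' ` V)" by blast
  then have "card (f ` V) \<le> card (insert (f u) (f' ` V))"
    using assms(1) by (intro card_mono) simp_all
  also have "\<dots> \<le> Suc (card (f' ` V))"
    using assms(1) by (simp add: card_insert_if)
  finally have "card (f ` V) \<le> Suc (card (f' ` V))" .
  moreover have "\<forall>(u, v)\<in>insert e S. f' u = f' v" using f(1) by (auto simp: f'_def e)
  ultimately show ?case using f(2) insert.hyps by (intro exI[of _ f']) simp
qed

text \<open>
  Rows are the vertices \<open>Inl i\<close> and columns the vertices \<open>Inr j\<close>.  No mass of \<open>A\<close> lies in a row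
  with label \<open>l\<close> and a column with another label or vice versa, so both sides are the mass of the
  block cut out by the label \<open>l\<close>.
\<close>

lemma balanced_label_class:
  fixes f :: "nat + nat \<Rightarrow> 'l"
  assumes A: "A \<in> ds_arrays n m"
    and f: "\<And>i j. (i, j) \<in> supp_mat A \<Longrightarrow> f (Inl i) = f (Inr j)"
  shows "card {i\<in>{..<n}. f (Inl i) = l} * m = card {j\<in>{..<m}. f (Inr j) = l} * n"
proof -
  let ?P = "{i\<in>{..<n}. f (Inl i) = l}" and ?Q = "{j\<in>{..<m}. f (Inr j) = l}"
  note a = ds_arraysD[OF A]
  have off: "A $$ (i, j) = 0" if "i < n" "j < m" "(f (Inl i) = l) \<noteq> (f (Inr j) = l)" for i j
  proof (rule ccontr)
    assume "A $$ (i, j) \<noteq> 0"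
    then have "(i, j) \<in> supp_mat A" using that(1,2) a(2,3) by (simp add: supp_mat_def)
    from f[OF this] that(3) show False by simp
  qed
  have "real (card ?P * m) = (\<Sum>i\<in>?P. \<Sum>j<m. A $$ (i, j))"
    using a(6) by simp
  also have "\<dots> = (\<Sum>i\<in>?P. \<Sum>j\<in>?Q. A $$ (i, j))"
    using off by (intro sum.cong refl sum.mono_neutral_right) auto
  also have "\<dots> = (\<Sum>j\<in>?Q. \<Sum>i\<in>?P. A $$ (i, j))"
    by (rule sum.swap)
  also have "\<dots> = (\<Sum>j\<in>?Q. \<Sum>i<n. A $$ (i, j))"
    using off by (intro sum.cong refl sum.mono_neutral_left) auto
  also have "\<dots> = real (card ?Q * n)"
    using a(5) by simp
  finally show ?thesis by linarith
qed

lemma le_mult_gcd_if_balanced: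
  fixes p q n m :: nat
  assumes "p * m = q * n" "0 < p \<or> 0 < q" "0 < n"
  shows "n \<le> p * gcd n m"
proof -
  have "n dvd gcd (p * n) (p * m)" using assms(1) by simp
  then have "n dvd p * gcd n m" by (simp add: gcd_mult_distrib_nat)
  moreover have "0 < p" using assms by (cases p) auto
  ultimately show ?thesis using assms(3) by (intro dvd_imp_le) simp_all
qed

text \<open>
  Every label class contains at least \<open>n / gcd n m\<close> of the \<open>n\<close> rows, so at most \<open>gcd n m\<close> labels
  occur.
\<close>

lemma card_supp_lower_bound:
  assumes A: "A \<in> ds_arrays n m" and n: "0 < n"
  shows "n + m - gcd n m \<le> card (supp_mat A)"
proof -
  define V :: "(nat + nat) set" where "V = Inl ` {..<n} \<union> Inr ` {..<m}"
  define S :: "((nat + nat) \<times> (nat + nat)) set"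
    where "S = (\<lambda>(i, j). (Inl i, Inr j)) ` supp_mat A"
  have "card S = card (supp_mat A)"
    unfolding S_def by (intro card_image) (auto simp: inj_on_def)
  moreover have "card V = n + m"
    unfolding V_def by (subst card_Un_disjoint) (auto simp: card_image)
  moreover have "finite V" "finite S" by (simp_all add: V_def S_def)
  ultimately obtain f :: "nat + nat \<Rightarrow> nat + nat"
    where f: "\<forall>(u, v)\<in>S. f u = f v" "n + m \<le> card (f ` V) + card (supp_mat A)"
    using edge_constant_labelling[of V S] by metis
  let ?P = "\<lambda>l. {i\<in>{..<n}. f (Inl i) = l}" and ?Q = "\<lambda>l. {j\<in>{..<m}. f (Inr j) = l}"
  have edge: "f (Inl i) = f (Inr j)" if "(i, j) \<in> supp_mat A" for i j
    using f(1) that by (force simp: S_def)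
  have large: "n \<le> card (?P l) * gcd n m" if l: "l \<in> f ` V" for l
  proof -
    have bal: "card (?P l) * m = card (?Q l) * n"
      by (rule balanced_label_class[OF A edge])
    have "?P l \<noteq> {} \<or> ?Q l \<noteq> {}" using l by (auto simp: V_def)
    then have "0 < card (?P l) \<or> 0 < card (?Q l)" by (auto simp: card_gt_0_iff)
    then show ?thesis using le_mult_gcd_if_balanced[OF bal] n by blast
  qed
  have "(\<Sum>l\<in>f ` V. card (?P l)) = (\<Sum>l\<in>f ` V. \<Sum>i\<in>?P l. 1)" by simp
  also have "\<dots> = (\<Sum>i<n. 1)"
    by (rule sum.group) (auto simp: V_def)
  finally have total: "(\<Sum>l\<in>f ` V. card (?P l)) = n" by simp
  have "n * card (f ` V) \<le> (\<Sum>l\<in>f ` V. card (?P l) * gcd n m)"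
    using sum_mono[of "f ` V" "\<lambda>_. n", OF large] by (simp add: mult.commute)
  also have "\<dots> = n * gcd n m"
    by (simp only: total sum_distrib_right[symmetric])
  finally have "card (f ` V) \<le> gcd n m" using n by simp
  then show ?thesis using f(2) by linarith
qed

section \<open>Minimum arrays are extremal\<close>

lemma smaller_support_exists:
  assumes A: "A \<in> ds_arrays n m" and B: "B \<in> ds_arrays n m" and "B \<noteq> A"
    and sub: "supp_mat B \<subseteq> supp_mat A"
  shows "\<exists>C\<in>ds_arrays n m. supp_mat C \<subset> supp_mat A"
proof -
  note a = ds_arraysD[OF A] and b = ds_arraysD[OF B]
  define K where "K = {(i, j) \<in> {..<n} \<times> {..<m}. B $$ (i, j) < A $$ (i, j)}"
  have "finite K" by (rule finite_subset[of _ "{..<n} \<times> {..<m}"]) (auto simp: K_def)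
  moreover have "K \<noteq> {}"
  proof
    assume "K = {}"
    then have le: "A $$ (i, j) \<le> B $$ (i, j)" if "i < n" "j < m" for i j
      using that by (force simp: K_def)
    have "A $$ (i, j) = B $$ (i, j)" if i: "i < n" and j: "j < m" for i j
    proof -
      have "(\<Sum>j<m. B $$ (i, j) - A $$ (i, j)) = 0"
        using a(6)[OF i] b(6)[OF i] by (simp add: sum_subtractf)
      then have "\<forall>j\<in>{..<m}. B $$ (i, j) - A $$ (i, j) = 0"
        using le[OF i] by (subst (asm) sum_nonneg_eq_0_iff) auto
      then show ?thesis using j by simp
    qed
    then have "B = A" using a b by (intro eq_matI) auto
    then show False using \<open>B \<noteq> A\<close> by contradiction
  qed
  ultimately obtain e where e: "e \<in> K"
    and least: "\<And>x. x \<in> K \<Longrightarrow> A $$ e / (A $$ e - B $$ e) \<le> A $$ x / (A $$ x - B $$ x)"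
    using ex_min_if_finite[of "(\<lambda>x. A $$ x / (A $$ x - B $$ x)) ` K"]
    by (force simp: not_less)
  \<comment> \<open>Only entries in \<open>K\<close> decrease along the ray \<open>A + t * (B - A)\<close>, and the entry at \<open>x\<close> reaches
    zero at \<open>t = A $$ x / (A $$ x - B $$ x)\<close>.  The first one to do so is at \<open>e\<close>.\<close>
  define t where "t = A $$ e / (A $$ e - B $$ e)"
  define C where "C = mat n m (\<lambda>x. A $$ x - t * (A $$ x - B $$ x))"
  have C: "C $$ (i, j) = A $$ (i, j) - t * (A $$ (i, j) - B $$ (i, j))" if "i < n" "j < m" for i j
    using that by (simp add: C_def)
  obtain p q where pq: "e = (p, q)" "p < n" "q < m" "B $$ e < A $$ e"
    using e by (auto simp: K_def)
  have "0 \<le> B $$ e" using b(4) pq by simp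
  then have t: "0 \<le> t" using pq(4) by (simp add: t_def)
  have Ce: "C $$ e = 0" using C[OF pq(2,3)] pq by (simp add: t_def)
  have "C \<in> ds_arrays n m"
  proof (rule ds_arraysI)
    show "C \<in> carrier_mat n m" by (simp add: C_def)
    show "C $$ (i, j) \<ge> 0" if "i < n" "j < m" for i j
    proof (cases "B $$ (i, j) < A $$ (i, j)")
      case True
      then have "(i, j) \<in> K" using that by (simp add: K_def)
      from least[OF this] True show ?thesis
        using C[OF that] by (simp add: t_def pos_le_divide_eq)
    next
      case False
      then have "t * (A $$ (i, j) - B $$ (i, j)) \<le> 0"
        using t by (simp add: mult_nonneg_nonpos)
      then show ?thesis using C[OF that] a(4)[OF that] by simp
    qed
    show "(\<Sum>i<n. C $$ (i, j)) = real n" if "j < m" for j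
      using that a(5) b(5) by (simp add: C sum_subtractf flip: sum_distrib_left)
    show "(\<Sum>j<m. C $$ (i, j)) = real m" if "i < n" for i
      using that a(6) b(6) by (simp add: C sum_subtractf flip: sum_distrib_left)
  qed
  moreover have "supp_mat C \<subseteq> supp_mat A"
  proof clarify
    fix i j assume ij: "(i, j) \<in> supp_mat C"
    show "(i, j) \<in> supp_mat A"
    proof (rule ccontr)
      assume no: "(i, j) \<notin> supp_mat A"
      then have "(i, j) \<notin> supp_mat B" using sub by auto
      then show False using ij no C[of i j] a b by (auto simp: supp_mat_def C_def)
    qed
  qed
  moreover have "e \<in> supp_mat A"
    using pq a \<open>0 \<le> B $$ e\<close> by (auto simp: supp_mat_def)
  moreover have "e \<notin> supp_mat C" using Ce pq(1) by (auto simp: supp_mat_def)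
  ultimately show ?thesis by blast
qed

text \<open>
  Any member with positive weight will do: the terms of an entry are nonnegative and cannot cancel.
\<close>

lemma convex_combination_member_support:
  assumes "convex_combination_of n m A X" and X: "X \<subseteq> ds_arrays n m"
  shows "\<exists>B\<in>X. supp_mat B \<subseteq> supp_mat A"
proof -
  obtain N and c :: "nat \<Rightarrow> real" and B :: "nat \<Rightarrow> real mat"
    where B: "\<forall>l<N. B l \<in> X \<and> c l \<ge> 0" and c: "(\<Sum>l<N. c l) = 1"
      and A: "A = mat n m (\<lambda>(i, j). \<Sum>l<N. c l * B l $$ (i, j))"
    using assms(1) unfolding convex_combination_of_def by blast
  obtain l where l: "l < N" "c l \<noteq> 0"
    using c by (metis lessThan_iff sum.neutral zero_neq_one)
  have dsB: "B k \<in> ds_arrays n m" if "k < N" for k using B X that by auto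
  have "supp_mat (B l) \<subseteq> supp_mat A"
  proof clarify
    fix i j assume "(i, j) \<in> supp_mat (B l)"
    then have ij: "i < n" "j < m" "B l $$ (i, j) \<noteq> 0"
      using ds_arraysD[OF dsB[OF l(1)]] by (auto simp: supp_mat_def)
    have "A $$ (i, j) \<noteq> 0"
    proof
      assume "A $$ (i, j) = 0"
      then have "(\<Sum>l<N. c l * B l $$ (i, j)) = 0" using ij A by simp
      moreover have "\<forall>l\<in>{..<N}. 0 \<le> c l * B l $$ (i, j)"
        using B ds_arraysD(4)[OF dsB ij(1,2)] by simp
      ultimately have "c l * B l $$ (i, j) = 0"
        using l(1) sum_nonneg_eq_0_iff[of "{..<N}" "\<lambda>l. c l * B l $$ (i, j)"] by auto
      then show False using l ij by simp
    qed
    then show "(i, j) \<in> supp_mat A" using ij A by (simp add: supp_mat_def)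
  qed
  then show ?thesis using B l by blast
qed

lemma min_supp_eqI:
  assumes "A \<in> ds_arrays n m"
    and "\<And>B. B \<in> ds_arrays n m \<Longrightarrow> card (supp_mat A) \<le> card (supp_mat B)"
  shows "min_supp n m = card (supp_mat A)"
proof -
  have "card (supp_mat B) \<le> n * m" if "B \<in> ds_arrays n m" for B
    using card_mono[OF _ supp_mat_subset[of B]] ds_arraysD(2,3)[OF that] by simp
  then have "{card (supp_mat B) |B. B \<in> ds_arrays n m} \<subseteq> {..n * m}" by auto
  then have "finite {card (supp_mat B) |B. B \<in> ds_arrays n m}" by (rule finite_subset) simp
  then show ?thesis unfolding min_supp_def using assms by (intro Min_eqI) auto
qed

lemma minimal_support_imp_extremal:
  assumes A: "A \<in> ds_arrays n m"
    and least: "\<And>B. B \<in> ds_arrays n m \<Longrightarrow> card (supp_mat A) \<le> card (supp_mat B)"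
  shows "extremal_array n m A"
  unfolding extremal_array_def
proof (intro conjI notI A)
  assume "convex_combination_of n m A (ds_arrays n m - {A})"
  then obtain B where B: "B \<in> ds_arrays n m" "B \<noteq> A" "supp_mat B \<subseteq> supp_mat A"
    using convex_combination_member_support[of n m A "ds_arrays n m - {A}"] by auto
  then obtain C where "C \<in> ds_arrays n m" "supp_mat C \<subset> supp_mat A"
    using smaller_support_exists[OF A] by blast
  then show False
    using least[of C] psubset_card_mono[of "supp_mat A" "supp_mat C"] by simp
qed

theorem lemma2p4:
  fixes n m :: nat
  assumes "1 < n" and "n \<le> m"
  shows "minimum_array n m (F_array n m) \<and>
         extremal_array n m (F_array n m) \<and>
         min_supp n m = card (supp_mat (F_array n m)) \<and>
         card (supp_mat (F_array n m)) = n + m - gcd n m"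
proof -
  have n: "0 < n" using assms by simp
  have F: "F_array n m \<in> ds_arrays n m" "card (supp_mat (F_array n m)) = n + m - gcd n m"
    using F_array_ds_arrays_and_card_supp[OF n] by auto
  have least: "card (supp_mat (F_array n m)) \<le> card (supp_mat B)" if "B \<in> ds_arrays n m" for B
    using card_supp_lower_bound[OF that n] F(2) by simp
  have "min_supp n m = card (supp_mat (F_array n m))"
    by (rule min_supp_eqI[OF F(1) least])
  moreover have "extremal_array n m (F_array n m)"
    by (rule minimal_support_imp_extremal[OF F(1) least])
  ultimately show ?thesis using F by (simp add: minimum_array_def)
qed

end
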